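(* Let $n,p\ge 1$ and $l_1,\dots,l_p\ge 1$ be fixed integers. Let $A$ be the set of all multichains $S=\{C_1,\dots,C_p\}$ over $[n]=\{1,\dots,n\}$ with $|C_i|=l_i$ whose chains all share the same last subset, and let $A'$ be the set of the encodings of the elements of $A$. Then there exists a universal cycle for $A'$.
   Context: A multichain here is a family $S=\{C_1,\dots,C_p\}$ (indexed by $1,\dots,p$) of chains of subsets of $[n]$, where $C_i$ is a chain $C_{i,1}\subseteq\cdots\subseteq C_{i,l_i-1}\subseteq D$ consisting of $l_i$ sets (inclusions not necessarily strict), all chains ending with the same set $D\subseteq[n]$; $D$ is not fixed in advance and varies over all subsets of $[n]$. For each $i$ let $S_i\in\mathbb{Z}_{\ge0}^n$ be the coordinatewise sum of the indicator vectors of the $l_i$ sets of $C_i$ (including $D$). The encoding of $S$ is the $n$-tuple $N$ whose $j$-th entry is the ordered $p$-tuple $N[j]=(S_1[j],\dots,S_p[j])$; in particular $N[j]=(0,\dots,0)$ if $j\notin D$. The encoding is viewed as a word of length $n$ whose letters are $p$-tuples. A universal cycle for a finite set $A'$ of words of length $n$ over a finite alphabet is a cyclic sequence $c_0c_1\cdots c_{L-1}$ of letters, with $L=|A'|$, such that every word of $A'$ occurs exactly once among the $L$ windows $c_ic_{i+1}\cdots c_{i+n-1}$, $0\le i<L$ (indices modulo $L$). *)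

theory Defs
  imports Main "HOL-Library.Indicator_Function"
begin

definition chain_ending_in :: "nat \<Rightarrow> nat \<Rightarrow> nat set \<Rightarrow> nat set list \<Rightarrow> bool" where
  "chain_ending_in n l D C \<longleftrightarrow>
     length C = l \<and> C \<noteq> [] \<and> set C \<subseteq> Pow {1..n} \<and> sorted_wrt (\<subseteq>) C \<and> last C = D"

(* The family C_1, ..., C_p and the lengths l_1, ..., l_p are lists, so positions are shifted
   by one.  The common last set D is existentially quantified: it varies with the multichain. *)
definition multichains :: "nat \<Rightarrow> nat list \<Rightarrow> nat set list list set" where
  "multichains n ls =
     {S. length S = length ls \<and>
         (\<exists>D \<subseteq> {1..n}. \<forall>i < length ls. chain_ending_in n (ls ! i) D (S ! i))}"

definition chain_sum :: "nat set list \<Rightarrow> nat \<Rightarrow> nat" where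
  "chain_sum C j = (\<Sum>X\<leftarrow>C. indicator X j)"

(* A letter, i.e. an ordered p-tuple, is a list of length p. *)
definition encoding :: "nat \<Rightarrow> nat set list list \<Rightarrow> nat list list" where
  "encoding n S = map (\<lambda>j. map (\<lambda>C. chain_sum C j) S) [1..<Suc n]"

definition cyclic_window :: "nat \<Rightarrow> 'a list \<Rightarrow> nat \<Rightarrow> 'a list" where
  "cyclic_window n c i = map (\<lambda>k. c ! ((i + k) mod length c)) [0..<n]"

(* Finiteness of W also makes the alphabet of letters occurring in W finite, and rules out
   the convention that card W = 0 for infinite W. *)
definition universal_cycle :: "nat \<Rightarrow> 'a list set \<Rightarrow> 'a list \<Rightarrow> bool" where
  "universal_cycle n W c \<longleftrightarrow>
     finite W \<and> (\<forall>w \<in> W. length w = n) \<and> length c = card W \<and>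
     (\<forall>w \<in> W. \<exists>!i. i < length c \<and> cyclic_window n c i = w)"

end

theory Submission
  imports Defs "Graph_Theory.Euler"
begin

text \<open>
  The sum vector of a chain with \<open>l\<close> members and last set \<open>D\<close> vanishes outside \<open>D\<close> and takes
  values between 1 and \<open>l\<close> on \<open>D\<close>; conversely, every such vector comes from a chain, namely the
  chain of its superlevel sets.  As the last set is common to all the chains of a multichain, the
  entries of an encoding are exactly the tuples that are zero or have all their coordinates
  positive, the \<open>i\<close>-th coordinate being bounded by the length of the \<open>i\<close>-th chain.  Since \<open>D\<close> is
  arbitrary, distinct positions of an encoding do not constrain each other: the encodings are all
  words of length \<open>n\<close> over a finite alphabet (\<open>encoding_multichains\<close>).

  A universal cycle for all words of length \<open>n\<close> is a de Bruijn sequence.  It is read off a closed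
  Euler trail in the de Bruijn graph, whose vertices are the words of length \<open>n - 1\<close> and whose arcs
  are the words of length \<open>n\<close>, an arc leading from its prefix to its suffix
  (\<open>universal_cycle_all_words\<close>).  Such a trail exists because every vertex can be extended by
  each letter on either side, so that its in-degree and out-degree agree, and because any vertex
  is reached from any other by feeding in its letters one after the other.
\<close>

section \<open>De Bruijn sequences\<close>

definition words :: "nat \<Rightarrow> 'a set \<Rightarrow> 'a list set" where
  "words n \<Sigma> = {w. length w = n \<and> set w \<subseteq> \<Sigma>}"

definition de_bruijn_graph :: "nat \<Rightarrow> 'a set \<Rightarrow> ('a list, 'a list) pre_digraph" where
  "de_bruijn_graph m \<Sigma> =
     \<lparr> verts = words m \<Sigma>, arcs = words (Suc m) \<Sigma>, tail = butlast, head = tl \<rparr>"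

lemma de_bruijn_graph_simps [simp]:
  "verts (de_bruijn_graph m \<Sigma>) = words m \<Sigma>"
  "arcs (de_bruijn_graph m \<Sigma>) = words (Suc m) \<Sigma>"
  "tail (de_bruijn_graph m \<Sigma>) = butlast"
  "head (de_bruijn_graph m \<Sigma>) = tl"
  by (simp_all add: de_bruijn_graph_def)

lemma finite_words: "finite \<Sigma> \<Longrightarrow> finite (words n \<Sigma>)"
  using finite_lists_length_eq[of \<Sigma> n] by (simp add: words_def conj_commute)

lemma fin_digraph_de_bruijn:
  assumes "finite \<Sigma>"
  shows "fin_digraph (de_bruijn_graph m \<Sigma>)"
proof
  fix e assume "e \<in> arcs (de_bruijn_graph m \<Sigma>)"
  then have e: "length e = Suc m" "set e \<subseteq> \<Sigma>"
    by (simp_all add: words_def)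
  show "tail (de_bruijn_graph m \<Sigma>) e \<in> verts (de_bruijn_graph m \<Sigma>)"
    using e by (auto simp: words_def length_Suc_conv_rev)
  show "head (de_bruijn_graph m \<Sigma>) e \<in> verts (de_bruijn_graph m \<Sigma>)"
    using e by (auto simp: words_def length_Suc_conv)
qed (simp_all add: assms finite_words)

lemma in_degree_de_bruijn:
  assumes "v \<in> words m \<Sigma>"
  shows "in_degree (de_bruijn_graph m \<Sigma>) v = card \<Sigma>"
proof -
  have "in_arcs (de_bruijn_graph m \<Sigma>) v = (\<lambda>x. x # v) ` \<Sigma>"
  proof (intro set_eqI iffI)
    fix e assume "e \<in> in_arcs (de_bruijn_graph m \<Sigma>) v"
    then show "e \<in> (\<lambda>x. x # v) ` \<Sigma>"
      by (cases e) (auto simp: in_arcs_def words_def)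
  qed (use assms in \<open>auto simp: in_arcs_def words_def\<close>)
  moreover have "inj_on (\<lambda>x. x # v) \<Sigma>"
    by (simp add: inj_on_def)
  ultimately show ?thesis
    by (simp add: in_degree_def card_image)
qed

lemma out_degree_de_bruijn:
  assumes "v \<in> words m \<Sigma>"
  shows "out_degree (de_bruijn_graph m \<Sigma>) v = card \<Sigma>"
proof -
  have "out_arcs (de_bruijn_graph m \<Sigma>) v = (\<lambda>x. v @ [x]) ` \<Sigma>"
  proof (intro set_eqI iffI)
    fix e assume "e \<in> out_arcs (de_bruijn_graph m \<Sigma>) v"
    then show "e \<in> (\<lambda>x. v @ [x]) ` \<Sigma>"
      by (cases e rule: rev_cases) (auto simp: out_arcs_def words_def)
  qed (use assms in \<open>auto simp: out_arcs_def words_def\<close>)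
  moreover have "inj_on (\<lambda>x. v @ [x]) \<Sigma>"
    by (simp add: inj_on_def)
  ultimately show ?thesis
    by (simp add: out_degree_def card_image)
qed

text \<open>
  Each arc shifts one new letter into the current vertex from the right, so walking along
  successive arcs feeds in any prescribed word.
\<close>

lemma reachable_de_bruijn_shift:
  assumes "finite \<Sigma>" "u \<in> words m \<Sigma>" "set xs \<subseteq> \<Sigma>"
  shows "u \<rightarrow>\<^sup>*\<^bsub>de_bruijn_graph m \<Sigma>\<^esub> drop (length xs) (u @ xs)"
  using assms(3)
proof (induction xs rule: rev_induct)
  interpret fin_digraph "de_bruijn_graph m \<Sigma>"
    by (rule fin_digraph_de_bruijn[OF assms(1)])
  case Nil
  show ?case
    using assms(2) by simp
next
  interpret fin_digraph "de_bruijn_graph m \<Sigma>"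
    by (rule fin_digraph_de_bruijn[OF assms(1)])
  case (snoc x xs)
  define e where "e = drop (length xs) (u @ xs) @ [x]"
  have "set (drop (length xs) (u @ xs)) \<subseteq> \<Sigma>"
    using assms(2) snoc.prems set_drop_subset[of "length xs" "u @ xs"]
    by (auto simp: words_def)
  then have "e \<in> arcs (de_bruijn_graph m \<Sigma>)"
    using assms(2) snoc.prems by (auto simp: e_def words_def)
  then have "tail (de_bruijn_graph m \<Sigma>) e \<rightarrow>\<^bsub>de_bruijn_graph m \<Sigma>\<^esub> head (de_bruijn_graph m \<Sigma>) e"
    by (rule in_arcs_imp_in_arcs_ends)
  moreover have "tl e = drop (length (xs @ [x])) (u @ xs @ [x])"
  proof -
    have "e = drop (length xs) (u @ xs @ [x])"
      by (simp add: e_def)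
    then show ?thesis
      by (simp only: drop_Suc tl_drop length_append_singleton)
  qed
  ultimately have "drop (length xs) (u @ xs) \<rightarrow>\<^bsub>de_bruijn_graph m \<Sigma>\<^esub>
      drop (length (xs @ [x])) (u @ xs @ [x])"
    by (simp only: de_bruijn_graph_simps e_def butlast_snoc)
  moreover have "u \<rightarrow>\<^sup>*\<^bsub>de_bruijn_graph m \<Sigma>\<^esub> drop (length xs) (u @ xs)"
    using snoc by simp
  ultimately show ?case
    by (rule reachable_adj_trans[rotated])
qed

lemma connected_de_bruijn:
  assumes "finite \<Sigma>" "\<Sigma> \<noteq> {}"
  shows "connected (de_bruijn_graph m \<Sigma>)"
proof -
  interpret fin_digraph "de_bruijn_graph m \<Sigma>"
    by (rule fin_digraph_de_bruijn[OF assms(1)])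
  obtain x where "x \<in> \<Sigma>"
    using assms(2) by blast
  then have "replicate m x \<in> words m \<Sigma>"
    by (auto simp: words_def)
  moreover have "u \<rightarrow>\<^sup>*\<^bsub>with_proj (mk_symmetric (de_bruijn_graph m \<Sigma>))\<^esub> v"
    if "u \<in> words m \<Sigma>" "v \<in> words m \<Sigma>" for u v
    using reachable_de_bruijn_shift[OF assms(1) that(1), of v] that
    by (intro reachable_mk_symmetricI) (auto simp: words_def)
  ultimately show ?thesis
    by (intro connectedI) auto
qed

lemma (in pre_digraph) cas_closed_nth:
  assumes "cas u p u" "i < length p"
  shows "head G (p ! i) = tail G (p ! (Suc i mod length p))"
proof -
  have consecutive: "(Suc i < length p \<longrightarrow> head G (p ! i) = tail G (p ! Suc i)) \<and>
      tail G (p ! 0) = u \<and> head G (p ! (length p - 1)) = v"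
    if "cas u p v" "i < length p" for u v p i
    using that
  proof (induction p arbitrary: u i)
    case (Cons e es)
    show ?case
    proof (cases es)
      case Nil
      then show ?thesis
        using Cons.prems by simp
    next
      case (Cons e' es')
      then show ?thesis
        using Cons.prems Cons.IH[of "head G e" "i - 1"] by (cases i) auto
    qed
  qed simp
  show ?thesis
  proof (cases "Suc i < length p")
    case False
    with assms(2) have "i = length p - 1" "Suc i = length p"
      by auto
    with consecutive[OF assms] show ?thesis
      by simp
  qed (use consecutive[OF assms] in simp)
qed

text \<open>
  Each arc agrees with its successor up to a shift by one, so the letter of an arc at position
  \<open>k\<close> is the first letter of the arc \<open>k\<close> steps further along.  Hence a closed trail is
  recovered, as its list of windows, from the first letters of its arcs.
\<close>

lemma nth_closed_shift_cycle:
  assumes shift: "\<And>i. i < length p \<Longrightarrow> tl (p ! i) = butlast (p ! (Suc i mod length p))"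
    and len: "\<And>w. w \<in> set p \<Longrightarrow> length w = n"
    and "i < length p" "k < n"
  shows "p ! i ! k = map hd p ! ((i + k) mod length p)"
  using assms(3,4)
proof (induction k arbitrary: i)
  case 0
  then have "p ! i \<noteq> []"
    using len[of "p ! i"] by auto
  then show ?case
    using 0 by (simp add: hd_conv_nth)
next
  case (Suc k)
  let ?j = "Suc i mod length p"
  have j: "?j < length p"
    using Suc.prems by (intro mod_less_divisor) auto
  have "p ! i ! Suc k = tl (p ! i) ! k"
    using Suc.prems len[of "p ! i"] by (simp add: nth_tl)
  also have "\<dots> = p ! ?j ! k"
    using Suc.prems len[of "p ! ?j"] j by (simp add: shift nth_butlast)
  also have "\<dots> = map hd p ! ((?j + k) mod length p)"
    using Suc j by simp
  also have "(?j + k) mod length p = (i + Suc k) mod length p"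
    by (simp add: mod_add_left_eq)
  finally show ?case .
qed

theorem universal_cycle_all_words:
  assumes "finite \<Sigma>" "\<Sigma> \<noteq> {}" "n \<ge> 1"
  shows "\<exists>c. universal_cycle n (words n \<Sigma>) c"
proof -
  obtain m where n: "n = Suc m"
    using assms(3) by (cases n) auto
  interpret fin_digraph "de_bruijn_graph m \<Sigma>"
    by (rule fin_digraph_de_bruijn[OF assms(1)])
  obtain u p where "euler_trail u p u"
    using closed_euler1[OF connected_de_bruijn[OF assms(1,2)]]
    by (auto simp: in_degree_de_bruijn out_degree_de_bruijn)
  then have p: "cas u p u" "distinct p" "set p = words n \<Sigma>"
    by (auto simp: euler_trail_def trail_def awalk_def n)
  have shift: "tl (p ! i) = butlast (p ! (Suc i mod length p))" if "i < length p" for i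
    using cas_closed_nth[OF p(1) that] by simp
  have window: "cyclic_window n (map hd p) i = p ! i" if "i < length p" for i
  proof (rule nth_equalityI)
    have len: "length w = n" if "w \<in> set p" for w
      using that by (simp add: p(3) words_def)
    show "length (cyclic_window n (map hd p) i) = length (p ! i)"
      using that by (simp add: cyclic_window_def len)
    fix k assume "k < length (cyclic_window n (map hd p) i)"
    then show "cyclic_window n (map hd p) i ! k = p ! i ! k"
      using nth_closed_shift_cycle[OF shift len that, of k] by (simp add: cyclic_window_def)
  qed
  have "\<exists>!i. i < length (map hd p) \<and> cyclic_window n (map hd p) i = w" if "w \<in> words n \<Sigma>" for w
  proof -
    have "w \<in> set p"
      using that by (simp only: p(3))
    then obtain i where i: "i < length p" "p ! i = w"
      by (auto simp only: in_set_conv_nth)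
    show ?thesis
    proof (rule ex1I[of _ i])
      fix j assume "j < length (map hd p) \<and> cyclic_window n (map hd p) j = w"
      then have "j < length p" "p ! j = p ! i"
        using i window[of j] by simp_all
      then show "j = i"
        using i nth_eq_iff_index_eq[OF p(2)] by blast
    qed (use i window[OF i(1)] in simp)
  qed
  moreover have "length (map hd p) = card (words n \<Sigma>)"
    using distinct_card[OF p(2)] by (simp add: p(3))
  ultimately have "universal_cycle n (words n \<Sigma>) (map hd p)"
    using finite_words[OF assms(1)] by (simp add: universal_cycle_def words_def)
  then show ?thesis ..
qed

section \<open>Sum vectors of chains\<close>

lemma chain_subset_last:
  assumes "chain_ending_in n l D C" "X \<in> set C"
  shows "X \<subseteq> D"
proof -
  have C: "C = butlast C @ [D]"
    using assms(1) by (metis append_butlast_last_id chain_ending_in_def)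
  then have "sorted_wrt (\<subseteq>) (butlast C @ [D])"
    using assms(1) by (metis chain_ending_in_def)
  moreover have "X \<in> set (butlast C) \<or> X = D"
    using assms(2) by (subst (asm) C) auto
  ultimately show ?thesis
    by (auto simp: sorted_wrt_append)
qed

lemma chain_sum_eq_0:
  assumes "chain_ending_in n l D C" "j \<notin> D"
  shows "chain_sum C j = 0"
  using chain_subset_last[OF assms(1)] assms(2)
  by (auto simp: chain_sum_def sum_list_eq_0_iff indicator_def)

lemma chain_sum_le: "chain_sum C j \<le> length C"
  unfolding chain_sum_def by (induction C) (auto simp: indicator_def)

lemma chain_sum_pos:
  assumes "chain_ending_in n l D C" "j \<in> D"
  shows "chain_sum C j \<ge> 1"
proof -
  have "D \<in> set C"
    using assms(1) by (auto simp: chain_ending_in_def)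
  then have "indicator D j \<le> chain_sum C j"
    unfolding chain_sum_def by (intro member_le_sum_list) auto
  then show ?thesis
    using assms(2) by simp
qed

text \<open>
  The thresholds decrease from \<open>l\<close> to 1, so the sets increase and the last one is the support
  of \<open>f\<close>.
\<close>

definition superlevel_chain :: "nat \<Rightarrow> nat \<Rightarrow> (nat \<Rightarrow> nat) \<Rightarrow> nat set list" where
  "superlevel_chain n l f = map (\<lambda>k. {j \<in> {1..n}. l - k \<le> f j}) [0..<l]"

lemma chain_ending_in_superlevel_chain:
  assumes "l \<ge> 1"
  shows "chain_ending_in n l {j \<in> {1..n}. 1 \<le> f j} (superlevel_chain n l f)"
  using assms
  by (auto simp: chain_ending_in_def superlevel_chain_def sorted_wrt_iff_nth_less last_map)

text \<open>
  A value \<open>f j \<le> l\<close> reaches exactly the thresholds \<open>1, \<dots>, f j\<close> among \<open>1, \<dots>, l\<close>.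
\<close>

lemma chain_sum_superlevel_chain:
  assumes "j \<in> {1..n}" "f j \<le> l"
  shows "chain_sum (superlevel_chain n l f) j = f j"
proof -
  have "chain_sum (superlevel_chain n l f) j =
      (\<Sum>k\<leftarrow>[0..<l]. indicator {k. l - k \<le> f j} k)"
    using assms(1)
    by (auto simp: chain_sum_def superlevel_chain_def comp_def indicator_def
        intro!: arg_cong[where f = sum_list])
  also have "\<dots> = (\<Sum>k<l. indicator {k. l - k \<le> f j} k)"
    by (simp add: interv_sum_list_conv_sum_set_nat atLeast0LessThan)
  also have "\<dots> = card ({..<l} \<inter> {k. l - k \<le> f j})"
    by (rule sum_indicator_eq_card) simp
  also have "{..<l} \<inter> {k. l - k \<le> f j} = {l - f j..<l}"
    by auto
  finally show ?thesis
    using assms(2) by simp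
qed

section \<open>The alphabet of the encodings\<close>

definition multichain_letters :: "nat list \<Rightarrow> nat list set" where
  "multichain_letters ls =
     insert (replicate (length ls) 0)
       {x. length x = length ls \<and> (\<forall>i < length ls. 1 \<le> x ! i \<and> x ! i \<le> ls ! i)}"

lemma finite_multichain_letters: "finite (multichain_letters ls)"
proof -
  have "x ! i \<le> sum_list ls"
    if "\<forall>i < length ls. 1 \<le> x ! i \<and> x ! i \<le> ls ! i" "i < length ls" for x :: "nat list" and i
    using that elem_le_sum_list[of i ls] by (meson le_trans)
  then have "multichain_letters ls \<subseteq> {x. set x \<subseteq> {..sum_list ls} \<and> length x = length ls}"
    by (auto simp: multichain_letters_def in_set_conv_nth)
  then show ?thesis
    by (rule finite_subset) (simp add: finite_lists_length_eq)
qed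

lemma nth_encoding:
  "j < n \<Longrightarrow> encoding n S ! j = map (\<lambda>C. chain_sum C (Suc j)) S"
  by (simp add: encoding_def del: upt_Suc)

lemma encoding_in_words:
  assumes "S \<in> multichains n ls"
  shows "encoding n S \<in> words n (multichain_letters ls)"
proof -
  obtain D where S: "length S = length ls"
    "\<And>i. i < length ls \<Longrightarrow> chain_ending_in n (ls ! i) D (S ! i)"
    using assms by (auto simp: multichains_def)
  have "map (\<lambda>C. chain_sum C j) S \<in> multichain_letters ls" for j
  proof (cases "j \<in> D")
    case True
    have "1 \<le> chain_sum (S ! i) j \<and> chain_sum (S ! i) j \<le> ls ! i" if "i < length ls" for i
      using chain_sum_pos[OF S(2)[OF that] True] chain_sum_le[of "S ! i" j] S(2)[OF that]
      by (simp add: chain_ending_in_def)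
    then show ?thesis
      by (simp add: multichain_letters_def S(1))
  next
    case False
    have "map (\<lambda>C. chain_sum C j) S = replicate (length ls) 0"
      using chain_sum_eq_0[OF S(2) False] by (intro nth_equalityI) (simp_all add: S(1))
    then show ?thesis
      by (simp add: multichain_letters_def)
  qed
  then show ?thesis
    by (auto simp: words_def encoding_def)
qed

lemma word_is_encoding:
  assumes "\<forall>l \<in> set ls. l \<ge> 1" "ls \<noteq> []" "w \<in> words n (multichain_letters ls)"
  shows "w \<in> encoding n ` multichains n ls"
proof -
  define p where "p = length ls"
  define f where "f i j = w ! (j - 1) ! i" for i j
  define S where "S = map (\<lambda>i. superlevel_chain n (ls ! i) (f i)) [0..<p]"
  define D where "D = {j \<in> {1..n}. 1 \<le> f 0 j}"
  have letter: "w ! (j - 1) \<in> multichain_letters ls" if "j \<in> {1..n}" for j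
  proof -
    have "w ! (j - 1) \<in> set w"
      using assms(3) that by (intro nth_mem) (auto simp: words_def)
    then show ?thesis
      using assms(3) by (auto simp: words_def)
  qed
  have le: "f i j \<le> ls ! i" if "i < p" "j \<in> {1..n}" for i j
    using letter[OF that(2)] that(1) by (auto simp: multichain_letters_def f_def p_def)
  \<comment> \<open>The chains share their last set because the coordinates of a letter vanish only together.\<close>
  have last: "{j \<in> {1..n}. 1 \<le> f i j} = D" if "i < p" for i
  proof -
    have "1 \<le> f i j \<longleftrightarrow> 1 \<le> f 0 j" if "j \<in> {1..n}" for j
      using letter[OF that] \<open>i < p\<close> assms(2)
      by (auto simp: multichain_letters_def f_def p_def)
    then show ?thesis
      unfolding D_def by blast
  qed
  have "chain_ending_in n (ls ! i) D (S ! i)" if "i < p" for i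
    using chain_ending_in_superlevel_chain[of "ls ! i" n "f i"] last[OF that] that assms(1)
    by (simp add: S_def p_def)
  then have "S \<in> multichains n ls"
    unfolding multichains_def by (auto simp: p_def S_def D_def intro!: exI[of _ D])
  moreover have "encoding n S = w"
  proof (rule nth_equalityI)
    show "length (encoding n S) = length w"
      using assms(3) by (simp add: encoding_def words_def)
    fix j assume "j < length (encoding n S)"
    then have j: "j < n"
      by (simp add: encoding_def del: upt_Suc)
    have "length (w ! j) = p"
      using letter[of "Suc j"] j by (auto simp: multichain_letters_def p_def)
    moreover have "chain_sum (superlevel_chain n (ls ! i) (f i)) (Suc j) = w ! j ! i"
      if "i < p" for i
      using chain_sum_superlevel_chain[of "Suc j" n "f i" "ls ! i"] le[OF that, of "Suc j"] j
      by (simp add: f_def)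
    ultimately show "encoding n S ! j = w ! j"
      using j by (intro nth_equalityI) (simp_all add: nth_encoding S_def)
  qed
  ultimately show ?thesis
    by blast
qed

lemma encoding_multichains:
  assumes "\<forall>l \<in> set ls. l \<ge> 1" "ls \<noteq> []"
  shows "encoding n ` multichains n ls = words n (multichain_letters ls)"
  using encoding_in_words word_is_encoding[OF assms] by blast

theorem theorem10:
  fixes n p :: nat and ls :: "nat list"
  assumes "n \<ge> 1" and "p \<ge> 1"
    and "length ls = p" and "\<forall>l \<in> set ls. l \<ge> 1"
  shows "\<exists>c. universal_cycle n (encoding n ` multichains n ls) c"
proof -
  have "ls \<noteq> []"
    using assms(2,3) by auto
  moreover have "multichain_letters ls \<noteq> {}"
    by (simp add: multichain_letters_def)
  ultimately show ?thesis
    using universal_cycle_all_words[OF finite_multichain_letters _ assms(1)]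
    by (simp add: encoding_multichains[OF assms(4)])
qed

end
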